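(* Let $(X,\sigma,\tau)$ be an indecomposable multipermutation solution of level at most $2$. Fix $\widetilde 0\in X$, let $\pi=\sigma_{\widetilde 0}$, let $n=o(\pi)\in\mathbb{N}\cup\{\infty\}$ be the order of $\pi$, and for $i\in\mathbb{Z}$ let $\widetilde i=\pi^i(\widetilde 0)$ and $L_{\widetilde i}=\sigma_{\widetilde i}\pi^{-1}$. Then $(X,\sigma,\tau)$ is a homomorphic image of the solution $\mathcal{S}(\mathrm{Dis}(X)\times\mathbb{Z}_n,\mathbf{c})$, where $\mathbf{c}=(c_i)_{i\in\mathbb{Z}_n}$ with $c_i=L_{\widetilde i}$.
   Context: $\mathbb{N}$ denotes the positive integers. $\mathbb{Z}_n=\mathbb{Z}/n\mathbb{Z}$ for finite $n$, and $\mathbb{Z}_\infty=\mathbb{Z}$. A solution (set-theoretic, non-degenerate, involutive solution of the Yang-Baxter equation) is a triple $(X,\sigma,\tau)$ with $X$ a non-empty set and $\sigma,\tau\colon X^2\to X$ such that, writing $\sigma_x=\sigma(x,\cdot)$ and $\tau_y=\tau(\cdot,y)$, the map $r(x,y)=(\sigma_x(y),\tau_y(x))$ is a bijection of $X^2$ satisfying $(\mathrm{id}\times r)(r\times \mathrm{id})(\mathrm{id}\times r)=(r\times \mathrm{id})(\mathrm{id}\times r)(r\times \mathrm{id})$, all $\sigma_x,\tau_y$ are bijections, and $r^2=\mathrm{id}$. It is indecomposable if $\mathcal{G}(X)=\langle\sigma_x\mid x\in X\rangle$ acts transitively on $X$. Put $x\sim y$ iff $\tau_x=\tau_y$. The quotient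 $X/{\sim}$ carries an induced solution, the retraction $\mathrm{Ret}(X)$. The solution has multipermutation level $1$ if $|\mathrm{Ret}(X)|=1$, and level $2$ if $|\mathrm{Ret}(X)|>1$ and $|\mathrm{Ret}(\mathrm{Ret}(X))|=1$. The displacement group is $\mathrm{Dis}(X)=\langle\sigma_x\sigma_y^{-1}\mid x,y\in X\rangle\le\mathrm{Sym}(X)$; for solutions of multipermutation level at most $2$ it is abelian. For an abelian group $(G,+,0)$ and a sequence $\mathbf{c}=(c_i)_{i\in\mathbb{Z}_n}$ in $G$ with $c_0=0$ whose members generate $G$, $\mathcal{S}(G\times\mathbb{Z}_n,\mathbf{c})$ denotes the solution $(G\times\mathbb{Z}_n,\sigma,\tau)$ with $\sigma_{(a,i)}((b,j))=(b+c_{i-j-1}-c_{-j-1},j+1)$ and $\tau_{(a,i)}((b,j))=(b-c_{i-j+1}+c_{-j},j-1)$. Here this is applied with $G=\mathrm{Dis}(X)$, whose group operation is composition of permutations. A homomorphism from $(X,\sigma,\tau)$ to $(X',\sigma',\tau')$ is a map $\Phi\colon X\to X'$ with $\Phi\sigma_x=\sigma'_{\Phi(x)}\Phi$ for all $x\in X$; a homomorphic image is the target of a surjective homomorphism. *)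

theory Defs
  imports "HOL-Algebra.Bij" "HOL-Algebra.Multiplicative_Group" "HOL-Algebra.Elementary_Groups"
begin

text \<open>The two operations are curried binary maps, in the argument order of
  \<open>r(x,y) = (\<sigma>(x,y), \<tau>(x,y))\<close>. So \<open>sigma S x y\<close> is \<open>\<sigma>\<^sub>x(y)\<close>, but \<open>tau S x y\<close> is \<open>\<tau>\<^sub>y(x)\<close>:
  the index of the permutation \<open>\<tau>\<^sub>y\<close> is the \<^emph>\<open>second\<close> argument. Values outside the carrier are
  irrelevant.\<close>

record 'a yb = "'a partial_object" +
  sigma :: "'a \<Rightarrow> 'a \<Rightarrow> 'a"
  tau :: "'a \<Rightarrow> 'a \<Rightarrow> 'a"

definition yb_map :: "'a yb \<Rightarrow> 'a \<times> 'a \<Rightarrow> 'a \<times> 'a" where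
  "yb_map S = (\<lambda>(x, y). (sigma S x y, tau S x y))"

definition map_times_id :: "('a \<times> 'a \<Rightarrow> 'a \<times> 'a) \<Rightarrow> 'a \<times> 'a \<times> 'a \<Rightarrow> 'a \<times> 'a \<times> 'a" where
  "map_times_id r = (\<lambda>(x, y, z). (fst (r (x, y)), snd (r (x, y)), z))"

definition id_times_map :: "('a \<times> 'a \<Rightarrow> 'a \<times> 'a) \<Rightarrow> 'a \<times> 'a \<times> 'a \<Rightarrow> 'a \<times> 'a \<times> 'a" where
  "id_times_map r = (\<lambda>(x, y, z). (x, r (y, z)))"

definition yb_solution :: "'a yb \<Rightarrow> bool" where
  "yb_solution S \<longleftrightarrow>
     (let X = carrier S; r = yb_map S in
        X \<noteq> {} \<and>
        bij_betw r (X \<times> X) (X \<times> X) \<and>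
        (\<forall>t \<in> X \<times> X \<times> X.
           (id_times_map r \<circ> map_times_id r \<circ> id_times_map r) t =
           (map_times_id r \<circ> id_times_map r \<circ> map_times_id r) t) \<and>
        (\<forall>x \<in> X. bij_betw (\<lambda>y. sigma S x y) X X) \<and>
        (\<forall>y \<in> X. bij_betw (\<lambda>x. tau S x y) X X) \<and>
        (\<forall>p \<in> X \<times> X. r (r p) = p))"

text \<open>The symmetric group on \<open>X\<close> is \<^const>\<open>BijGroup\<close>: its elements are bijections that are
  \<^const>\<open>undefined\<close> off \<open>X\<close>, whence the restriction below, and its product is composition.\<close>

definition sigma_perm :: "'a yb \<Rightarrow> 'a \<Rightarrow> 'a \<Rightarrow> 'a" where
  "sigma_perm S x = restrict (sigma S x) (carrier S)"

definition perm_group :: "'a yb \<Rightarrow> ('a \<Rightarrow> 'a) set" where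
  "perm_group S = generate (BijGroup (carrier S)) (sigma_perm S ` carrier S)"

definition indecomposable :: "'a yb \<Rightarrow> bool" where
  "indecomposable S \<longleftrightarrow> (\<forall>x \<in> carrier S. \<forall>y \<in> carrier S. \<exists>g \<in> perm_group S. g x = y)"

definition Dis :: "'a yb \<Rightarrow> ('a \<Rightarrow> 'a) monoid" where
  "Dis S = (BijGroup (carrier S))
     \<lparr>carrier := generate (BijGroup (carrier S))
        {sigma_perm S x \<otimes>\<^bsub>BijGroup (carrier S)\<^esub> inv\<^bsub>BijGroup (carrier S)\<^esub> sigma_perm S y | x y.
          x \<in> carrier S \<and> y \<in> carrier S}\<rparr>"

definition ret_rel :: "'a yb \<Rightarrow> ('a \<times> 'a) set" where
  "ret_rel S = {(x, y). x \<in> carrier S \<and> y \<in> carrier S \<and>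
                        (\<forall>z \<in> carrier S. tau S z x = tau S z y)}"

text \<open>The operations on classes are induced from representatives, as in the lifting lemmas of
  \<^theory>\<open>HOL.Equiv_Relations\<close>: when the operation respects the relation, all classes in the union
  coincide.\<close>

definition Ret :: "'a yb \<Rightarrow> 'a set yb" where
  "Ret S =
     \<lparr>carrier = carrier S // ret_rel S,
      sigma = (\<lambda>A B. \<Union>a\<in>A. \<Union>b\<in>B. ret_rel S `` {sigma S a b}),
      tau = (\<lambda>A B. \<Union>a\<in>A. \<Union>b\<in>B. ret_rel S `` {tau S a b})\<rparr>"

definition mp_level_1 :: "'a yb \<Rightarrow> bool" where
  "mp_level_1 S \<longleftrightarrow> card (carrier (Ret S)) = 1"

text \<open>``More than one element'' is not written with \<^const>\<open>card\<close>, which is \<open>0\<close> on infinite sets.\<close>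

definition mp_level_2 :: "'a yb \<Rightarrow> bool" where
  "mp_level_2 S \<longleftrightarrow>
     (\<exists>A \<in> carrier (Ret S). \<exists>B \<in> carrier (Ret S). A \<noteq> B) \<and> card (carrier (Ret (Ret S))) = 1"

text \<open>\<open>\<int>\<^sub>n\<close> is \<^const>\<open>integer_mod_group\<close>, with \<open>n = 0\<close> standing for \<open>n = \<infinity>\<close>: its carrier is
  \<open>{0..<n}\<close> for \<open>n > 0\<close> and all of \<open>\<int>\<close> for \<open>n = 0\<close>, where also \<open>k mod 0 = k\<close>. The same convention
  for infinite order is built into \<^const>\<open>group.ord\<close>. A family indexed by \<open>\<int>\<^sub>n\<close> is an \<open>n\<close>-periodic
  function on \<open>\<int>\<close>.\<close>

definition generating_seq :: "('g, 'm) monoid_scheme \<Rightarrow> nat \<Rightarrow> (int \<Rightarrow> 'g) \<Rightarrow> bool" where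
  "generating_seq G n c \<longleftrightarrow>
     (\<forall>i. c i \<in> carrier G) \<and> (\<forall>i. c (i mod int n) = c i) \<and>
     c 0 = \<one>\<^bsub>G\<^esub> \<and> generate G (range c) = carrier G"

definition seq_yb :: "('g, 'm) monoid_scheme \<Rightarrow> nat \<Rightarrow> (int \<Rightarrow> 'g) \<Rightarrow> ('g \<times> int) yb" where
  "seq_yb G n c =
     \<lparr>carrier = carrier G \<times> carrier (integer_mod_group n),
      sigma = (\<lambda>(a, i) (b, j).
        (b \<otimes>\<^bsub>G\<^esub> c (i - j - 1) \<otimes>\<^bsub>G\<^esub> inv\<^bsub>G\<^esub> c (- j - 1), (j + 1) mod int n)),
      tau = (\<lambda>(b, j) (a, i).
        (b \<otimes>\<^bsub>G\<^esub> inv\<^bsub>G\<^esub> c (i - j + 1) \<otimes>\<^bsub>G\<^esub> c (- j), (j - 1) mod int n))\<rparr>"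

definition yb_hom :: "'a yb \<Rightarrow> 'b yb \<Rightarrow> ('a \<Rightarrow> 'b) set" where
  "yb_hom S T = {\<Phi> \<in> carrier S \<rightarrow> carrier T.
     \<forall>x \<in> carrier S. \<forall>y \<in> carrier S. \<Phi> (sigma S x y) = sigma T (\<Phi> x) (\<Phi> y)}"

definition homomorphic_image :: "'b yb \<Rightarrow> 'a yb \<Rightarrow> bool" where
  "homomorphic_image T S \<longleftrightarrow>
     yb_solution S \<and> yb_solution T \<and> (\<exists>\<Phi> \<in> yb_hom S T. \<Phi> ` carrier S = carrier T)"

end

theory Submission
  imports Defs
begin

text \<open>Multipermutation level at most \<open>2\<close> makes \<open>\<sigma>\<^bsub>\<sigma>\<^sub>u(y)\<^esub>\<close> independent of \<open>u\<close>. The relation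
  \<open>\<sigma>\<^sub>x \<sigma>\<^sub>y = \<sigma>\<^bsub>\<sigma>\<^sub>x(y)\<^esub> \<sigma>\<^bsub>\<tau>\<^sub>y(x)\<^esub>\<close> then becomes the exchange law
  \<open>\<sigma>\<^bsub>\<pi>(b)\<^esub> \<sigma>\<^sub>a = \<sigma>\<^bsub>\<pi>(a)\<^esub> \<sigma>\<^sub>b\<close>, from which it follows that the displacement group is abelian and that
  \<open>g (\<sigma>\<^sub>b \<sigma>\<^sub>a\<^sup>-\<^sup>1) g\<^sup>-\<^sup>1 = \<sigma>\<^bsub>g(b)\<^esub> \<sigma>\<^bsub>g(a)\<^esub>\<^sup>-\<^sup>1\<close> for all \<open>g\<close> in the permutation group. By indecomposability every
  \<open>\<sigma>\<^sub>x\<close> is some \<open>\<sigma>\<close> at \<open>\<pi>\<^sup>i(z)\<close>. With the conjugation formula for \<open>g = \<pi>\<^sup>j\<^sup>+\<^sup>1\<close>, the map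
  \<open>(b, j) \<mapsto> \<pi>\<^sup>j(b(z))\<close> is seen to be a surjective homomorphism.\<close>

section \<open>Preliminaries on groups and residues\<close>

lemma (in group) generate_comm_group:
  assumes H: "H \<subseteq> carrier G" and comm: "\<And>h k. h \<in> H \<Longrightarrow> k \<in> H \<Longrightarrow> h \<otimes> k = k \<otimes> h"
  shows "comm_group (G\<lparr>carrier := generate G H\<rparr>)"
proof -
  define C where "C K = {g \<in> carrier G. \<forall>k\<in>K. g \<otimes> k = k \<otimes> g}" for K
  have C: "subgroup (C K) G" if K: "K \<subseteq> carrier G" for K
  proof
    show "inv x \<in> C K" if "x \<in> C K" for x
    proof -
      have "inv x \<otimes> k = k \<otimes> inv x" if "k \<in> K" for k
      proof -
        have kc: "k \<in> carrier G" "x \<in> carrier G" "x \<otimes> k = k \<otimes> x"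
          using K \<open>x \<in> C K\<close> that by (auto simp: C_def)
        then have "x \<otimes> (k \<otimes> inv x) = k"
          by (metis inv_closed m_assoc r_inv r_one)
        with kc show ?thesis
          by (metis inv_closed inv_solve_left m_closed)
      qed
      with that show ?thesis by (auto simp: C_def)
    qed
    show "x \<otimes> y \<in> C K" if "x \<in> C K" "y \<in> C K" for x y
    proof -
      have "x \<otimes> y \<otimes> k = k \<otimes> (x \<otimes> y)" if "k \<in> K" for k
        using K \<open>x \<in> C K\<close> \<open>y \<in> C K\<close> that unfolding C_def
        by (smt (verit) m_assoc mem_Collect_eq subsetD)
      with that show ?thesis by (auto simp: C_def)
    qed
  qed (use K in \<open>auto simp: C_def\<close>)
  have sub: "generate G H \<subseteq> carrier G"
    by (rule generate_incl[OF H])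
  \<comment> \<open>Centralizers are used twice: that of \<open>H\<close> is a subgroup containing
    \<open>H\<close>, hence contains \<open>generate G H\<close>; so that of
    \<open>generate G H\<close> contains \<open>H\<close>, and hence all of
    \<open>generate G H\<close>.\<close>
  have "H \<subseteq> C H"
    using H comm by (auto simp: C_def)
  then have "generate G H \<subseteq> C H"
    by (rule generate_subgroup_incl[OF _ C[OF H]])
  then have "H \<subseteq> C (generate G H)"
    using H by (auto simp: C_def)
  then have "generate G H \<subseteq> C (generate G H)"
    by (rule generate_subgroup_incl[OF _ C[OF sub]])
  then show ?thesis
    by (intro group.group_comm_groupI subgroup_imp_group generate_is_subgroup H) (auto simp: C_def)
qed

lemma (in group) inv_mult_cancel:
  assumes "x \<in> carrier G" "y \<in> carrier G"
  shows "inv x \<otimes> (x \<otimes> y) = y" "x \<otimes> (inv x \<otimes> y) = y"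
  using assms by (simp_all flip: m_assoc)

lemma mod_in_carrier_integer_mod_group [simp]: "i mod int n \<in> carrier (integer_mod_group n)"
  by (auto simp: carrier_integer_mod_group)

lemma carrier_integer_mod_group_mod: "i \<in> carrier (integer_mod_group n) \<Longrightarrow> i mod int n = i"
  by (auto simp: carrier_integer_mod_group split: if_splits)

section \<open>The solution built from an abelian group and a sequence\<close>

lemma yb_solutionI:
  fixes S :: "'a yb"
  defines "X \<equiv> carrier S"
  assumes "X \<noteq> {}"
    and sig: "\<And>x. x \<in> X \<Longrightarrow> bij_betw (\<lambda>y. sigma S x y) X X"
    and tau: "\<And>y. y \<in> X \<Longrightarrow> bij_betw (\<lambda>x. tau S x y) X X"
    and inv1: "\<And>x y. x \<in> X \<Longrightarrow> y \<in> X \<Longrightarrow> sigma S (sigma S x y) (tau S x y) = x"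
    and inv2: "\<And>x y. x \<in> X \<Longrightarrow> y \<in> X \<Longrightarrow> tau S (sigma S x y) (tau S x y) = y"
    and yb1: "\<And>x y w. x \<in> X \<Longrightarrow> y \<in> X \<Longrightarrow> w \<in> X \<Longrightarrow>
      sigma S x (sigma S y w) = sigma S (sigma S x y) (sigma S (tau S x y) w)"
    and yb2: "\<And>x y w. x \<in> X \<Longrightarrow> y \<in> X \<Longrightarrow> w \<in> X \<Longrightarrow>
      sigma S (tau S x (sigma S y w)) (tau S y w) = tau S (sigma S x y) (sigma S (tau S x y) w)"
    and yb3: "\<And>x y w. x \<in> X \<Longrightarrow> y \<in> X \<Longrightarrow> w \<in> X \<Longrightarrow>
      tau S (tau S x (sigma S y w)) (tau S y w) = tau S (tau S x y) w"
  shows "yb_solution S"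
proof -
  have cl: "sigma S x y \<in> X" "tau S x y \<in> X" if "x \<in> X" "y \<in> X" for x y
    using bij_betwE[OF sig[OF that(1)]] bij_betwE[OF tau[OF that(2)]] that by auto
  \<comment> \<open>Involutivity makes \<open>yb_map S\<close> its own inverse. The assumptions
    \<open>yb1\<close>, \<open>yb2\<close>, \<open>yb3\<close> are the three coordinates of the
    braid relation.\<close>
  have "bij_betw (yb_map S) (X \<times> X) (X \<times> X)"
    by (rule bij_betw_byWitness[where f' = "yb_map S"]) (auto simp: yb_map_def cl inv1 inv2)
  then show ?thesis
    using assms unfolding yb_solution_def Let_def
    by (auto simp: id_times_map_def map_times_id_def yb_map_def)
qed

text \<open>The permutations attached to a point depend only on its second coordinate, so two
  families \<open>F\<close> and \<open>H\<close> describe them all. The coordinates of the braid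
  relation become the exchange identities \<open>FF\<close>, \<open>FHc\<close> and
  \<open>HH\<close>.\<close>

lemma (in comm_group) seq_yb_solution:
  assumes gen: "generating_seq G n c"
  shows "yb_solution (seq_yb G n c)"
proof -
  define X where "X = carrier G \<times> carrier (integer_mod_group n)"
  have c [simp]: "c i \<in> carrier G" for i
    using gen by (simp add: generating_seq_def)
  have per: "c i = c j" if "i mod int n = j mod int n" for i j
    using gen that by (metis generating_seq_def)
  define F where "F = (\<lambda>k (b, j). (b \<otimes> (c (k - j - 1) \<otimes> inv c (- j - 1)), (j + 1) mod int n))"
  define H where "H = (\<lambda>k (b, j). (b \<otimes> (inv c (k - j) \<otimes> c (- j)), (j - 1) mod int n))"
  \<comment> \<open>\<open>F k\<close> and \<open>H k\<close> are mutually inverse; \<open>\<tau>\<close> carries the index shift \<open>k = i + 1\<close>.\<close>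
  have S: "carrier (seq_yb G n c) = X"
    "\<And>x y. x \<in> X \<Longrightarrow> y \<in> X \<Longrightarrow> sigma (seq_yb G n c) x y = F (snd x) y"
    "\<And>x y. x \<in> X \<Longrightarrow> y \<in> X \<Longrightarrow> tau (seq_yb G n c) x y = H (snd y + 1) x"
    by (auto simp: seq_yb_def X_def F_def H_def m_assoc algebra_simps)
  have Fc [simp]: "F k x \<in> X" and Hc [simp]: "H k x \<in> X" if "x \<in> X" for k x
    using that by (auto simp: X_def F_def H_def)
  have snd: "snd (F k x) = (snd x + 1) mod int n" "snd (H k x) = (snd x - 1) mod int n" for k x
    by (auto simp: F_def H_def split: prod.splits)
  have canc: "b \<otimes> (inv u \<otimes> v) \<otimes> (u \<otimes> inv v) = b" "b \<otimes> (u \<otimes> inv v) \<otimes> (inv u \<otimes> v) = b"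
    if "b \<in> carrier G" "u \<in> carrier G" "v \<in> carrier G" for b u v
  proof -
    have "(inv u \<otimes> v) \<otimes> (u \<otimes> inv v) = (u \<otimes> inv u) \<otimes> (v \<otimes> inv v)"
      "(u \<otimes> inv v) \<otimes> (inv u \<otimes> v) = (u \<otimes> inv u) \<otimes> (v \<otimes> inv v)"
      using that by (simp_all only: m_ac m_closed inv_closed)
    then have 1: "(inv u \<otimes> v) \<otimes> (u \<otimes> inv v) = \<one>" "(u \<otimes> inv v) \<otimes> (inv u \<otimes> v) = \<one>"
      using that by simp_all
    show "b \<otimes> (inv u \<otimes> v) \<otimes> (u \<otimes> inv v) = b" "b \<otimes> (u \<otimes> inv v) \<otimes> (inv u \<otimes> v) = b"
      using that by (simp_all add: m_assoc[of b] 1)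
  qed
  have Fper: "F k = F l" and Hper: "H k = H l" if "k mod int n = l mod int n" for k l
  proof -
    have "c (k - j - 1) = c (l - j - 1)" "c (k - j) = c (l - j)" for j
      by (auto intro!: per mod_diff_cong that)
    then show "F k = F l" "H k = H l" by (auto simp: F_def H_def)
  qed
  have FH: "F k (H k x) = x" and HF: "H k (F k x) = x" if x: "x \<in> X" for k x
  proof -
    obtain b j where [simp]: "x = (b, j)" by (cases x)
    have b: "b \<in> carrier G" "j mod int n = j"
      using x by (auto simp: X_def carrier_integer_mod_group_mod)
    \<comment> \<open>Second coordinates are stored reduced modulo \<open>n\<close>; periodicity of
      \<open>c\<close> removes the reduction inside indices.\<close>
    have "c (k - (j - 1) mod int n - 1) = c (k - j)" "c (- ((j - 1) mod int n) - 1) = c (- j)"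
      "c (k - (j + 1) mod int n) = c (k - j - 1)" "c (- ((j + 1) mod int n)) = c (- j - 1)"
      by (intro per; simp only: mod_eq_dvd_iff; simp add: minus_mult_div_eq_mod[symmetric])+
    then show "F k (H k x) = x" "H k (F k x) = x"
      using b by (auto simp: F_def H_def canc mod_simps)
  qed
  have FF: "F k (F l x) = F (l + 1) (F (k - 1) x)" if x: "x \<in> X" for k l x
  proof -
    obtain b j where [simp]: "x = (b, j)" by (cases x)
    have b: "b \<in> carrier G"
      using x by (auto simp: X_def)
    have e: "c (k - (j + 1) mod int n - 1) = c (k - j - 2)" 
      "c (l + 1 - (j + 1) mod int n - 1) = c (l - j - 1)"
      by (intro per; simp only: mod_eq_dvd_iff; simp add: minus_mult_div_eq_mod[symmetric])+
    have e': "k - 1 - j - 1 = k - j - 2"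
      by simp
    show ?thesis
      using b unfolding F_def e e' \<open>x = (b, j)\<close> prod.case
      by (simp add: m_ac)
  qed
  \<comment> \<open>As \<open>H k\<close> inverts \<open>F k\<close>, this is \<open>FF\<close> read
    backwards from the point \<open>y\<close>.\<close>
  have HH: "H k (H l x) = H (l - 1) (H (k + 1) x)" if x: "x \<in> X" for k l x
  proof -
    define y where "y = H (l - 1) (H (k + 1) x)"
    have y: "y \<in> X"
      using x by (simp add: y_def)
    have "F l (F k y) = F (k + 1) (F (l - 1) y)"
      using FF[OF y, of "k + 1" "l - 1"] by simp
    also have "\<dots> = x"
      using x by (simp add: y_def FH)
    finally have "H k (H l x) = H k (H l (F l (F k y)))"
      by simp
    also have "\<dots> = y"
      using y by (simp add: HF)
    finally show ?thesis
      by (simp add: y_def)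
  qed
  have FHc: "F (k - 1) (H (l + 1) x) = H (l + 2) (F k x)" if x: "x \<in> X" for k l x
  proof -
    obtain b j where [simp]: "x = (b, j)" by (cases x)
    have b: "b \<in> carrier G" "j mod int n = j"
      using x by (auto simp: X_def carrier_integer_mod_group_mod)
    have e: "c (k - 1 - (j - 1) mod int n - 1) = c (k - j - 1)" "c (- ((j - 1) mod int n) - 1) = c (- j)"
      "c (l + 2 - (j + 1) mod int n) = c (l + 1 - j)" "c (- ((j + 1) mod int n)) = c (- j - 1)"
      by (intro per; simp only: mod_eq_dvd_iff; simp add: minus_mult_div_eq_mod[symmetric])+
    \<comment> \<open>To be used with \<open>u = c (- j)\<close> and \<open>v = c (- j - 1)\<close>:
      the base terms cancel on each side and leave the same factor
      \<open>p \<otimes> q\<close>.\<close>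
    have canc': "b \<otimes> (p \<otimes> u) \<otimes> (q \<otimes> inv u) = b \<otimes> (q \<otimes> inv v) \<otimes> (p \<otimes> v)"
      if "p \<in> carrier G" "q \<in> carrier G" "u \<in> carrier G" "v \<in> carrier G" for p q u v
    proof -
      have "(p \<otimes> u) \<otimes> (q \<otimes> inv u) = p \<otimes> q \<otimes> (u \<otimes> inv u)"
        "(q \<otimes> inv v) \<otimes> (p \<otimes> v) = p \<otimes> q \<otimes> (v \<otimes> inv v)"
        using that by (simp_all only: m_ac m_closed inv_closed)
      with b that show ?thesis by (simp add: m_assoc[of b])
    qed
    show ?thesis
      unfolding F_def H_def e \<open>x = (b, j)\<close> prod.case by (simp add: canc' mod_simps)
  qed
  show ?thesis
  proof (rule yb_solutionI, unfold S(1))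
    show "X \<noteq> {}" unfolding X_def using one_closed integer_mod_group_0 by blast
  next
    fix x assume x: "x \<in> X"
    have "bij_betw (F (snd x)) X X"
      by (rule bij_betw_byWitness[where f' = "H (snd x)"]) (auto simp: FH HF)
    then show "bij_betw (sigma (seq_yb G n c) x) X X"
      using x by (subst bij_betw_cong[OF S(2)])
    have "bij_betw (H (snd x + 1)) X X"
      by (rule bij_betw_byWitness[where f' = "F (snd x + 1)"]) (auto simp: FH HF)
    then show "bij_betw (\<lambda>y. tau (seq_yb G n c) y x) X X"
      using x by (subst bij_betw_cong[OF S(3)])
  next
    fix x y assume xy: "x \<in> X" "y \<in> X"
    \<comment> \<open>The shift by one in \<open>tau\<close> matters here: \<open>sigma\<close>
      moves \<open>y\<close> to second coordinate \<open>snd y + 1\<close>, so the next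
      \<open>F\<close> undoes exactly \<open>H (snd y + 1)\<close>.\<close>
    have "F ((snd y + 1) mod int n) = F (snd y + 1)" 
      "H ((snd x - 1) mod int n + 1) = H (snd x)"
      by (intro Fper Hper; simp only: mod_eq_dvd_iff; simp add: minus_mult_div_eq_mod[symmetric])+
    with xy show "sigma (seq_yb G n c) (sigma (seq_yb G n c) x y) (tau (seq_yb G n c) x y) = x"
      "tau (seq_yb G n c) (sigma (seq_yb G n c) x y) (tau (seq_yb G n c) x y) = y"
      by (simp_all add: S snd FH HF)
  next
    fix x y w assume xyw: "x \<in> X" "y \<in> X" "w \<in> X"
    have e: "F ((snd y + 1) mod int n) = F (snd y + 1)" "F ((snd x - 1) mod int n) = F (snd x - 1)"
      "H ((snd y - 1) mod int n + 1) = H (snd y)" "H ((snd w + 1) mod int n + 1) = H (snd w + 2)"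
      by (intro Fper Hper; simp only: mod_eq_dvd_iff; simp add: minus_mult_div_eq_mod[symmetric])+
    show "sigma (seq_yb G n c) x (sigma (seq_yb G n c) y w) =
        sigma (seq_yb G n c) (sigma (seq_yb G n c) x y) (sigma (seq_yb G n c) (tau (seq_yb G n c) x y) w)"
      using xyw by (simp add: S snd e FF[symmetric])
    show "sigma (seq_yb G n c) (tau (seq_yb G n c) x (sigma (seq_yb G n c) y w)) (tau (seq_yb G n c) y w) =
        tau (seq_yb G n c) (sigma (seq_yb G n c) x y) (sigma (seq_yb G n c) (tau (seq_yb G n c) x y) w)"
      using xyw by (simp add: S snd e FHc)
    have "H (snd w + 1) (H (snd y + 1) x) = H (snd y) (H (snd w + 2) x)"
      using HH[of x "snd w + 1" "snd y + 1"] xyw by (simp add: algebra_simps)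
    with xyw show "tau (seq_yb G n c) (tau (seq_yb G n c) x (sigma (seq_yb G n c) y w)) (tau (seq_yb G n c) y w) =
        tau (seq_yb G n c) (tau (seq_yb G n c) x y) w"
      by (simp add: S snd e)
  qed
qed

section \<open>Solutions and their retractions\<close>

locale yb =
  fixes S :: "'a yb" and X and G
  defines "X \<equiv> carrier S" and "G \<equiv> BijGroup X"
  assumes yb: "yb_solution S"
begin

abbreviation sg where "sg \<equiv> sigma S"
abbreviation ta where "ta \<equiv> tau S"
abbreviation s where "s \<equiv> sigma_perm S"

lemma bij_sigma: "x \<in> X \<Longrightarrow> bij_betw (sg x) X X"
  and bij_tau: "y \<in> X \<Longrightarrow> bij_betw (\<lambda>x. ta x y) X X"
  using yb by (simp_all add: yb_solution_def Let_def X_def)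

lemma closed [simp]:
  assumes "x \<in> X" "y \<in> X"
  shows sigma_closed: "sg x y \<in> X" and tau_closed: "ta x y \<in> X"
  using bij_betwE[OF bij_sigma[OF assms(1)]] bij_betwE[OF bij_tau[OF assms(2)]] assms by auto

lemma sigma_cancel: "x \<in> X \<Longrightarrow> y \<in> X \<Longrightarrow> w \<in> X \<Longrightarrow> sg x y = sg x w \<longleftrightarrow> y = w"
  and tau_cancel: "x \<in> X \<Longrightarrow> y \<in> X \<Longrightarrow> w \<in> X \<Longrightarrow> ta y x = ta w x \<longleftrightarrow> y = w"
  using inj_on_eq_iff[OF bij_betw_imp_inj_on[OF bij_sigma], of x y w]
    inj_on_eq_iff[OF bij_betw_imp_inj_on[OF bij_tau], of x y w]
  by simp_all

lemma sigma_surj: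
  assumes "x \<in> X" "y \<in> X"
  obtains w where "w \<in> X" "sg x w = y"
  using bij_betw_imp_surj_on[OF bij_sigma[OF assms(1)]] assms(2) by force

lemma tau_surj:
  assumes "x \<in> X" "y \<in> X"
  obtains w where "w \<in> X" "ta w x = y"
  using bij_betw_imp_surj_on[OF bij_tau[OF assms(1)]] assms(2) by force

lemma sigma_involutive: "x \<in> X \<Longrightarrow> y \<in> X \<Longrightarrow> sg (sg x y) (ta x y) = x"
  and tau_involutive: "x \<in> X \<Longrightarrow> y \<in> X \<Longrightarrow> ta (sg x y) (ta x y) = y"
  using yb by (auto simp: yb_solution_def Let_def X_def yb_map_def)

lemma sigma_sigma: "x \<in> X \<Longrightarrow> y \<in> X \<Longrightarrow> w \<in> X \<Longrightarrow> sg x (sg y w) = sg (sg x y) (sg (ta x y) w)"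
  using yb
  by (auto simp: yb_solution_def Let_def X_def yb_map_def id_times_map_def map_times_id_def)

lemma s_apply: "y \<in> X \<Longrightarrow> s x y = sg x y"
  by (simp add: sigma_perm_def X_def)

lemma s_eq_iff: "s x = s y \<longleftrightarrow> (\<forall>w\<in>X. sg x w = sg y w)"
  by (metis (no_types, lifting) X_def restrict_ext s_apply sigma_perm_def)

sublocale G: group G
  by (simp add: G_def group_BijGroup)

lemma s_closed [simp]: "x \<in> X \<Longrightarrow> s x \<in> carrier G"
  using bij_sigma by (auto simp: G_def BijGroup_def Bij_def sigma_perm_def X_def)

lemma G_eqI:
  assumes "f \<in> carrier G" "g \<in> carrier G" "\<And>x. x \<in> X \<Longrightarrow> f x = g x"
  shows "f = g"
  using assms by (auto simp: G_def BijGroup_def Bij_def intro: extensionalityI)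

lemma G_apply_closed [simp]: "f \<in> carrier G \<Longrightarrow> x \<in> X \<Longrightarrow> f x \<in> X"
  using Bij_imp_funcset by (fastforce simp: G_def BijGroup_def)

lemma G_apply_mult [simp]:
  "f \<in> carrier G \<Longrightarrow> g \<in> carrier G \<Longrightarrow> x \<in> X \<Longrightarrow> (f \<otimes>\<^bsub>G\<^esub> g) x = f (g x)"
  by (simp add: G_def BijGroup_def compose_def)

lemma G_apply_one [simp]: "x \<in> X \<Longrightarrow> \<one>\<^bsub>G\<^esub> x = x"
  by (simp add: G_def BijGroup_def)

lemma G_apply_inv [simp]:
  assumes "f \<in> carrier G" "x \<in> X"
  shows "f ((inv\<^bsub>G\<^esub> f) x) = x" "(inv\<^bsub>G\<^esub> f) (f x) = x"
  using assms by (metis G.inv_closed G.l_inv G.r_inv G_apply_mult G_apply_one)+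

lemma s_mult: "x \<in> X \<Longrightarrow> y \<in> X \<Longrightarrow> s x \<otimes>\<^bsub>G\<^esub> s y = s (sg x y) \<otimes>\<^bsub>G\<^esub> s (ta x y)"
  by (rule G_eqI) (simp_all add: s_apply sigma_sigma[of x y])

text \<open>With \<open>T(x) = \<sigma>\<^sub>x\<^sup>-\<^sup>1(x)\<close>, the next lemma says \<open>\<sigma>\<^sub>v T \<tau>\<^sub>v = T\<close>. As \<open>T\<close> is bijective with inverse
  \<open>y \<mapsto> \<tau>\<^sub>y\<^sup>-\<^sup>1(y)\<close>, the permutations \<open>\<sigma>\<^sub>v\<close> and \<open>\<tau>\<^sub>v\<close> determine each other.\<close>

lemma sigma_diagonal:
  assumes "x \<in> X" "v \<in> X" "p \<in> X" "q \<in> X" "sg x p = x" "sg (ta x v) q = ta x v"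
  shows "sg v q = p"
proof -
  have "sg x (sg v q) = sg x p"
    using assms by (simp add: sigma_sigma[of x v] sigma_involutive)
  with assms show ?thesis
    using sigma_cancel[of x "sg v q" p] by simp
qed

text \<open>Surjectivity of \<open>T\<close>. If \<open>ta x q = q\<close>, then involutivity gives
  \<open>ta (sg x q) q = q\<close> as well, and injectivity of \<open>\<tau>\<^sub>q\<close> forces
  \<open>sg x q = x\<close>.\<close>

lemma ex_diagonal:
  assumes "q \<in> X"
  obtains x where "x \<in> X" "sg x q = x"
proof -
  obtain x where x: "x \<in> X" "ta x q = q"
    using tau_surj[OF assms assms] .
  have "ta (sg x q) q = ta x q"
    using tau_involutive[of x q] x assms by simp
  with x assms have "sg x q = x"
    using tau_cancel[of q "sg x q" x] by simp
  with x that show thesis by blast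
qed

text \<open>The bridge from \<open>ret_rel\<close>, defined by \<open>tau\<close>, to equality of
  the permutations \<open>s\<close>, in which the later arguments are phrased. By
  \<open>sigma_diagonal\<close> the value \<open>sg v q\<close> is determined by a point
  \<open>x\<close> that serves \<open>v\<close> and \<open>w\<close> alike.\<close>

lemma tau_eq_imp_s_eq:
  assumes v: "v \<in> X" "w \<in> X" and eq: "\<And>x. x \<in> X \<Longrightarrow> ta x v = ta x w"
  shows "s v = s w"
  unfolding s_eq_iff
proof
  fix q assume q: "q \<in> X"
  obtain y where y: "y \<in> X" "sg y q = y"
    using ex_diagonal[OF q] .
  obtain x where x: "x \<in> X" "ta x v = y"
    using tau_surj[OF v(1) y(1)] .
  obtain p where p: "p \<in> X" "sg x p = x"
    using sigma_surj[OF x(1) x(1)] .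
  show "sg v q = sg w q"
    using sigma_diagonal[of x v p q] sigma_diagonal[of x w p q] x y p q v eq[of x] by simp
qed

text \<open>By involutivity \<open>sg (sg u a)\<close> sends \<open>ta u a\<close> to
  \<open>u\<close>, and likewise for \<open>a'\<close>. If these permutations agree, then
  \<open>ta u a = ta u a'\<close>, and cancelling in \<open>s_mult\<close> leaves
  \<open>s a = s a'\<close>.\<close>

lemma s_eq_lift:
  assumes "u \<in> X" "a \<in> X" "a' \<in> X" "s (sg u a) = s (sg u a')"
  shows "s a = s a'"
proof -
  have "sg (sg u a) (ta u a) = sg (sg u a') (ta u a')"
    using assms by (simp add: sigma_involutive)
  also have "\<dots> = sg (sg u a) (ta u a')"
    using assms(1,3,4) by (metis s_apply tau_closed)
  finally have "ta u a = ta u a'"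
    using assms by (simp add: sigma_cancel)
  then have "s u \<otimes>\<^bsub>G\<^esub> s a = s u \<otimes>\<^bsub>G\<^esub> s a'"
    using assms s_mult[of u a] s_mult[of u a'] by simp
  with assms show ?thesis by simp
qed

text \<open>In \<open>s_mult\<close> for \<open>a\<close> and \<open>u\<close>, the product and the
  first factor on the right depend on \<open>a\<close> only through \<open>s a\<close>; hence so
  does the second factor.\<close>

lemma tau_class:
  assumes "u \<in> X" "a \<in> X" "a' \<in> X" "s a = s a'"
  shows "s (ta a u) = s (ta a' u)"
proof -
  have "sg a u = sg a' u"
    using assms(1,4) by (metis s_apply)
  then have "s (sg a u) \<otimes>\<^bsub>G\<^esub> s (ta a u) = s (sg a u) \<otimes>\<^bsub>G\<^esub> s (ta a' u)"
    using s_mult[of a u] s_mult[of a' u] assms by metis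
  with assms show ?thesis by simp
qed

text \<open>The conclusion says that \<open>\<tau>\<close> on the retraction does not depend on its index; this is all
  that is used of the multipermutation level.\<close>

lemma mp_level_imp_tau_indep:
  assumes "mp_level_1 S \<or> mp_level_2 S" "x \<in> X" "y \<in> X" "w \<in> X"
  shows "s (ta w x) = s (ta w y)"
proof -
  define C where "C x = ret_rel S `` {x}" for x
  have C_refl: "x \<in> C x" if "x \<in> X" for x
    using that by (simp add: C_def ret_rel_def X_def)
  have C_X: "C x \<subseteq> X" for x
    by (auto simp: C_def ret_rel_def X_def)
  have C_tau: "ta w x = ta w y" if "y \<in> C x" "w \<in> X" for x y w
    using that by (simp add: C_def ret_rel_def X_def)
  have C_s: "s x = s y" if "y \<in> C x" for x y
    using that by (intro tau_eq_imp_s_eq) (auto simp: C_def ret_rel_def X_def)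
  have carr: "carrier (Ret S) = C ` X"
    by (auto simp: Ret_def quotient_def C_def X_def)
  from assms(1) show ?thesis
  proof
    assume "mp_level_1 S"
    then obtain K where "C ` X = {K}"
      unfolding mp_level_1_def carr by (auto simp: card_1_singleton_iff)
    then have "C (ta w x) = C (ta w y)"
      using assms by (metis image_eqI singletonD tau_closed)
    then show ?thesis
      using C_refl[of "ta w x"] C_s[of "ta w x" "ta w y"] assms by simp
  next
    assume "mp_level_2 S"
    then have "card (carrier (Ret S) // ret_rel (Ret S)) = 1"
      by (simp add: mp_level_2_def Ret_def)
    then obtain K where K: "carrier (Ret S) // ret_rel (Ret S) = {K}"
      by (auto simp: card_1_singleton_iff)
    have "ret_rel (Ret S) `` {C u} = K" if "u \<in> X" for u
      using quotientI[of "C u" "carrier (Ret S)" "ret_rel (Ret S)"] that K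
      by (simp add: carr)
    then have "ret_rel (Ret S) `` {C x} = ret_rel (Ret S) `` {C y}"
      using assms by simp
    moreover have "C y \<in> ret_rel (Ret S) `` {C y}"
      using assms by (simp add: ret_rel_def carr)
    ultimately have "(C x, C y) \<in> ret_rel (Ret S)"
      by blast
    then have "tau (Ret S) (C w) (C x) = tau (Ret S) (C w) (C y)"
      using assms by (simp add: ret_rel_def carr)
    then have eq: "(\<Union>a\<in>C w. \<Union>b\<in>C x. C (ta a b)) = (\<Union>a\<in>C w. \<Union>b\<in>C y. C (ta a b))"
      by (simp add: Ret_def C_def)
    \<comment> \<open>Equality of the unions only yields some representatives \<open>a\<close> and
      \<open>b\<close>; \<open>C_tau\<close> then replaces \<open>b\<close> by \<open>y\<close>, and
      \<open>tau_class\<close> replaces \<open>a\<close> by \<open>w\<close>.\<close>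
    have "ta w x \<in> (\<Union>a\<in>C w. \<Union>b\<in>C x. C (ta a b))"
      using C_refl assms tau_closed by blast
    then obtain a b where ab: "a \<in> C w" "b \<in> C y" "ta w x \<in> C (ta a b)"
      unfolding eq by blast
    then have "s (ta w x) = s (ta a b)"
      by (metis C_s)
    also have "\<dots> = s (ta a y)"
      using ab C_X[of w] by (metis C_tau subsetD)
    also have "\<dots> = s (ta w y)"
      using ab C_X[of w] C_s[of a w] assms by (intro tau_class) auto
    finally show ?thesis .
  qed
qed

end

section \<open>Multipermutation level at most 2\<close>

locale yb_level_le_2 = yb +
  assumes tau_indep: "x \<in> X \<Longrightarrow> y \<in> X \<Longrightarrow> w \<in> X \<Longrightarrow> s (ta w x) = s (ta w y)"
begin

lemma sigma_class:
  assumes "u \<in> X" "x \<in> X" "y \<in> X" "s x = s y"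
  shows "s (sg u x) = s (sg u y)"
proof -
  have "s (sg u x) \<otimes>\<^bsub>G\<^esub> s (ta u x) = s (sg u y) \<otimes>\<^bsub>G\<^esub> s (ta u x)"
    using s_mult[of u x] s_mult[of u y] tau_indep[of x y u] assms by metis
  with assms show ?thesis by simp
qed

text \<open>For \<open>T(x) = p\<close> one has
  \<open>\<sigma>\<^sub>u\<^sup>-\<^sup>1(p) = T(\<tau>\<^sub>u(x))\<close>. By
  \<open>tau_indep\<close> the points \<open>ta x v\<close> and \<open>ta x w\<close> have the same
  \<open>s\<close>; this one permutation sends \<open>p'\<close> and \<open>p''\<close> to these
  points, so \<open>s_eq_lift\<close> applies.\<close>

lemma sigma_inv_indep:
  assumes X: "v \<in> X" "w \<in> X" "p \<in> X" "p' \<in> X" "p'' \<in> X" and p': "sg v p' = p" and p'': "sg w p'' = p"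
  shows "s p' = s p''"
proof -
  obtain x where x: "x \<in> X" "sg x p = x"
    using ex_diagonal[OF X(3)] .
  have diag: "sg (ta x u) q = ta x u" if u: "u \<in> X" "q \<in> X" "sg u q = p" for u q
  proof -
    obtain q' where q': "q' \<in> X" "sg (ta x u) q' = ta x u"
      using sigma_surj[of "ta x u" "ta x u"] x u by auto
    then have "sg u q' = sg u q"
      using sigma_diagonal[of x u p q'] x u X by simp
    with q' u show ?thesis
      using sigma_cancel[of u q' q] by simp
  qed
  have eq: "s (ta x v) = s (ta x w)"
    by (rule tau_indep[OF X(1,2) x(1)])
  have "sg (ta x v) p'' = sg (ta x w) p''"
    using eq X(5) by (metis s_apply)
  also have "\<dots> = ta x w"
    by (rule diag[OF X(2,5) p''])
  finally have "s (sg (ta x v) p') = s (sg (ta x v) p'')"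
    unfolding diag[OF X(1,4) p'] by (simp add: eq)
  then show ?thesis
    using s_eq_lift[of "ta x v" p' p''] X(1,4,5) x(1) by (metis tau_closed)
qed

text \<open>The preimage of \<open>sg u y\<close> under \<open>sg v\<close> has the same
  \<open>s\<close> as \<open>y\<close> by \<open>sigma_inv_indep\<close>; \<open>sigma_class\<close>
  carries this forward along \<open>sg v\<close>.\<close>

lemma sigma_indep:
  assumes "u \<in> X" "v \<in> X" "y \<in> X"
  shows "s (sg u y) = s (sg v y)"
proof -
  obtain y' where y': "y' \<in> X" "sg v y' = sg u y"
    using sigma_surj[of v "sg u y"] assms by auto
  then have "s y = s y'"
    using sigma_inv_indep[of u v "sg u y" y y'] assms by simp
  then have "s (sg v y) = s (sg v y')"
    using sigma_class[of v y y'] assms y' by simp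
  then show ?thesis
    using y' by simp
qed

text \<open>This is \<open>s_mult\<close> for \<open>x = sg e b\<close> and the \<open>a'\<close>
  with \<open>sg x a' = sg e a\<close>. By \<open>sigma_indep\<close> and \<open>s_eq_lift\<close>,
  \<open>a'\<close> may be replaced by \<open>a\<close> and \<open>ta x a'\<close> by
  \<open>b\<close>.\<close>

lemma s_swap:
  assumes "a \<in> X" "b \<in> X" "e \<in> X"
  shows "s (sg e b) \<otimes>\<^bsub>G\<^esub> s a = s (sg e a) \<otimes>\<^bsub>G\<^esub> s b"
proof -
  define x u where "x = sg e b" and "u = sg e a"
  have x: "x \<in> X" and u: "u \<in> X"
    using assms by (simp_all add: x_def u_def)
  obtain a' where a': "a' \<in> X" "sg x a' = u"
    using sigma_surj[OF x u] .
  have "s (sg e a') = s (sg e a)"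
    using sigma_indep[of e x a'] a' x assms by (simp add: u_def)
  then have "s a' = s a"
    using s_eq_lift[of e a' a] a' assms by simp
  moreover have "s (sg e (ta x a')) = s (sg e b)"
    using sigma_indep[of e u "ta x a'"] sigma_involutive[of x a'] a' x u assms by (simp add: x_def)
  then have "s (ta x a') = s b"
    using s_eq_lift[of e "ta x a'" b] a' x assms by simp
  ultimately show ?thesis
    using s_mult[of x a'] x a' by (simp add: x_def u_def)
qed

text \<open>The exchange law for the \<open>e\<close> with \<open>sg z e = z\<close>. Only the
  middle factor depends on \<open>y\<close>, so in a quotient of two such values \<open>s e\<close>
  cancels and conjugation by \<open>s z\<close> remains.\<close>

lemma s_shift:
  assumes "z \<in> X"
  obtains e where "e \<in> X" "\<And>y. y \<in> X \<Longrightarrow> s (sg z y) = s z \<otimes>\<^bsub>G\<^esub> s y \<otimes>\<^bsub>G\<^esub> inv\<^bsub>G\<^esub> s e"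
proof -
  obtain e where e: "e \<in> X" "sg z e = z"
    using sigma_surj[OF assms assms] .
  then have "s (sg z y) = s z \<otimes>\<^bsub>G\<^esub> s y \<otimes>\<^bsub>G\<^esub> inv\<^bsub>G\<^esub> s e" if "y \<in> X" for y
    using s_swap[of e y z] that assms by (simp add: G.inv_solve_right)
  with e that show thesis by blast
qed

text \<open>It suffices that \<open>s x \<otimes> inv (s z) \<otimes> s y\<close> is symmetric in
  \<open>x\<close> and \<open>y\<close>; by \<open>s_shift\<close> it equals
  \<open>s x \<otimes> s y' \<otimes> inv (s e)\<close>, whose symmetry is the exchange law.\<close>

lemma displacement_comm:
  assumes "x \<in> X" "y \<in> X" "z \<in> X"
  shows "(s x \<otimes>\<^bsub>G\<^esub> inv\<^bsub>G\<^esub> s z) \<otimes>\<^bsub>G\<^esub> (s y \<otimes>\<^bsub>G\<^esub> inv\<^bsub>G\<^esub> s z) =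
    (s y \<otimes>\<^bsub>G\<^esub> inv\<^bsub>G\<^esub> s z) \<otimes>\<^bsub>G\<^esub> (s x \<otimes>\<^bsub>G\<^esub> inv\<^bsub>G\<^esub> s z)"
proof -
  obtain x' y' where x': "x' \<in> X" "sg z x' = x" and y': "y' \<in> X" "sg z y' = y"
    using sigma_surj assms by metis
  obtain e where e: "e \<in> X" "\<And>y. y \<in> X \<Longrightarrow> s (sg z y) = s z \<otimes>\<^bsub>G\<^esub> s y \<otimes>\<^bsub>G\<^esub> inv\<^bsub>G\<^esub> s e"
    using s_shift[OF assms(3)] by blast
  have inv_s: "inv\<^bsub>G\<^esub> s z \<otimes>\<^bsub>G\<^esub> s (sg z w) = s w \<otimes>\<^bsub>G\<^esub> inv\<^bsub>G\<^esub> s e" if "w \<in> X" for w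
    using that e assms by (simp add: G.m_assoc G.inv_mult_cancel)
  have "s x \<otimes>\<^bsub>G\<^esub> (inv\<^bsub>G\<^esub> s z \<otimes>\<^bsub>G\<^esub> s y) = (s x \<otimes>\<^bsub>G\<^esub> s y') \<otimes>\<^bsub>G\<^esub> inv\<^bsub>G\<^esub> s e"
    using inv_s[of y'] y' e assms by (simp add: G.m_assoc)
  also have "\<dots> = (s y \<otimes>\<^bsub>G\<^esub> s x') \<otimes>\<^bsub>G\<^esub> inv\<^bsub>G\<^esub> s e"
    using s_swap[of y' x' z] x' y' assms by simp
  also have "\<dots> = s y \<otimes>\<^bsub>G\<^esub> (inv\<^bsub>G\<^esub> s z \<otimes>\<^bsub>G\<^esub> s x)"
    using inv_s[of x'] x' e assms by (simp add: G.m_assoc)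
  finally have "s x \<otimes>\<^bsub>G\<^esub> (inv\<^bsub>G\<^esub> s z \<otimes>\<^bsub>G\<^esub> s y) \<otimes>\<^bsub>G\<^esub> inv\<^bsub>G\<^esub> s z =
      s y \<otimes>\<^bsub>G\<^esub> (inv\<^bsub>G\<^esub> s z \<otimes>\<^bsub>G\<^esub> s x) \<otimes>\<^bsub>G\<^esub> inv\<^bsub>G\<^esub> s z"
    by simp
  then show ?thesis
    using assms by (simp add: G.m_assoc)
qed

section \<open>Action of the permutation group on displacements and classes\<close>

lemma perm_group_subgroup: "subgroup (perm_group S) G"
  unfolding perm_group_def by (fold X_def G_def) (auto intro: G.generate_is_subgroup)

lemma perm_group_closed [simp]: "g \<in> perm_group S \<Longrightarrow> g \<in> carrier G"
  by (rule subgroup.mem_carrier[OF perm_group_subgroup])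

lemma s_in_perm_group: "x \<in> X \<Longrightarrow> s x \<in> perm_group S"
  unfolding perm_group_def by (auto simp: X_def intro: generate.incl)

lemma perm_group_induct [consumes 1, case_names one s inv mult]:
  assumes "g \<in> perm_group S"
    and "P \<one>\<^bsub>G\<^esub>" "\<And>x. x \<in> X \<Longrightarrow> P (s x)" "\<And>x. x \<in> X \<Longrightarrow> P (inv\<^bsub>G\<^esub> s x)"
    and mult: "\<And>g h. g \<in> carrier G \<Longrightarrow> h \<in> carrier G \<Longrightarrow> P g \<Longrightarrow> P h \<Longrightarrow> P (g \<otimes>\<^bsub>G\<^esub> h)"
  shows "P g"
proof -
  have "g \<in> generate G (s ` X)"
    using assms(1) by (simp add: perm_group_def G_def X_def)
  then have "g \<in> carrier G \<and> P g"
    by (induction rule: generate.induct) (use assms in auto)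
  then show ?thesis ..
qed

text \<open>With \<open>g\<close> on both sides, the product case just moves two factors across in
  turn. Generators are handled by \<open>s_shift\<close>, their inverses by the same formula at the
  preimages of \<open>a\<close> and \<open>b\<close>.\<close>

lemma displacement_conj:
  assumes "g \<in> perm_group S" "a \<in> X" "b \<in> X"
  shows "g \<otimes>\<^bsub>G\<^esub> (s b \<otimes>\<^bsub>G\<^esub> inv\<^bsub>G\<^esub> s a) = (s (g b) \<otimes>\<^bsub>G\<^esub> inv\<^bsub>G\<^esub> s (g a)) \<otimes>\<^bsub>G\<^esub> g"
  using assms
proof (induction arbitrary: a b rule: perm_group_induct)
  case one
  then show ?case by simp
next
  case (s x)
  obtain e where e: "e \<in> X" "\<And>y. y \<in> X \<Longrightarrow> s (sg x y) = s x \<otimes>\<^bsub>G\<^esub> s y \<otimes>\<^bsub>G\<^esub> inv\<^bsub>G\<^esub> s e"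
    using s_shift[OF s(1)] by blast
  show ?case
    using s e by (simp add: s_apply G.m_assoc G.inv_mult_group G.inv_mult_cancel)
next
  case (inv x)
  obtain e where e: "e \<in> X" "\<And>y. y \<in> X \<Longrightarrow> s (sg x y) = s x \<otimes>\<^bsub>G\<^esub> s y \<otimes>\<^bsub>G\<^esub> inv\<^bsub>G\<^esub> s e"
    using s_shift[OF inv(1)] by blast
  define a' b' where "a' = (inv\<^bsub>G\<^esub> s x) a" and "b' = (inv\<^bsub>G\<^esub> s x) b"
  have a': "a' \<in> X" "sg x a' = a" and b': "b' \<in> X" "sg x b' = b"
    using inv by (simp_all add: a'_def b'_def flip: s_apply)
  have "s b \<otimes>\<^bsub>G\<^esub> inv\<^bsub>G\<^esub> s a = s x \<otimes>\<^bsub>G\<^esub> (s b' \<otimes>\<^bsub>G\<^esub> inv\<^bsub>G\<^esub> s a') \<otimes>\<^bsub>G\<^esub> inv\<^bsub>G\<^esub> s x"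
    using e(2)[of a'] e(2)[of b'] a' b' e(1) inv by (simp add: G.m_assoc G.inv_mult_group G.inv_mult_cancel)
  with a' b' inv show ?case
    by (simp add: G.m_assoc G.inv_mult_cancel flip: a'_def b'_def)
next
  case (mult g h)
  have "(g \<otimes>\<^bsub>G\<^esub> h) \<otimes>\<^bsub>G\<^esub> (s b \<otimes>\<^bsub>G\<^esub> inv\<^bsub>G\<^esub> s a) = g \<otimes>\<^bsub>G\<^esub> (h \<otimes>\<^bsub>G\<^esub> (s b \<otimes>\<^bsub>G\<^esub> inv\<^bsub>G\<^esub> s a))"
    using mult.hyps mult.prems by (simp add: G.m_assoc)
  also have "\<dots> = (g \<otimes>\<^bsub>G\<^esub> (s (h b) \<otimes>\<^bsub>G\<^esub> inv\<^bsub>G\<^esub> s (h a))) \<otimes>\<^bsub>G\<^esub> h"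
    using mult.hyps mult.prems by (simp add: mult.IH(2) G.m_assoc)
  also have "\<dots> = (s (g (h b)) \<otimes>\<^bsub>G\<^esub> inv\<^bsub>G\<^esub> s (g (h a))) \<otimes>\<^bsub>G\<^esub> g \<otimes>\<^bsub>G\<^esub> h"
    using mult.hyps mult.prems by (simp add: mult.IH(1))
  finally show ?case
    using mult.hyps mult.prems by (simp add: G.m_assoc)
qed

text \<open>Equal \<open>s\<close> means trivial displacement, and conjugation by \<open>g\<close>
  keeps it trivial.\<close>

lemma perm_group_class:
  assumes "g \<in> perm_group S" "a \<in> X" "b \<in> X" "s a = s b"
  shows "s (g a) = s (g b)"
proof -
  have "\<one>\<^bsub>G\<^esub> \<otimes>\<^bsub>G\<^esub> g = (s (g b) \<otimes>\<^bsub>G\<^esub> inv\<^bsub>G\<^esub> s (g a)) \<otimes>\<^bsub>G\<^esub> g"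
    using displacement_conj[OF assms(1-3)] assms by simp
  then have "\<one>\<^bsub>G\<^esub> = s (g b) \<otimes>\<^bsub>G\<^esub> inv\<^bsub>G\<^esub> s (g a)"
    using assms by (subst (asm) G.right_cancel) simp_all
  then show ?thesis
    using assms by (metis G.inv_closed G.inv_inv G.inv_equality G_apply_closed perm_group_closed s_closed)
qed

end

section \<open>The covering map\<close>

locale yb_base_point = yb_level_le_2 +
  fixes z \<pi> n pt c
  assumes indec: "indecomposable S"
    and z: "z \<in> X"
    and \<pi>: "\<pi> = s z"
    and n: "n = G.ord \<pi>"
    and pt: "pt i = (\<pi> [^]\<^bsub>G\<^esub> (i :: int)) z"
    and c: "c i = s (pt i) \<otimes>\<^bsub>G\<^esub> inv\<^bsub>G\<^esub> \<pi>"
begin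

lemma \<pi>_closed [simp]: "\<pi> \<in> carrier G"
  by (simp add: \<pi> z)

lemma pow_in_perm_group: "\<pi> [^]\<^bsub>G\<^esub> (i :: int) \<in> perm_group S"
  unfolding \<pi> by (intro G.subgroup_int_pow_closed perm_group_subgroup s_in_perm_group z)

text \<open>This covers infinite order too: there \<open>n = 0\<close>, and reduction modulo
  \<open>0\<close> is the identity.\<close>

lemma pow_mod: "\<pi> [^]\<^bsub>G\<^esub> (i mod int n) = \<pi> [^]\<^bsub>G\<^esub> i"
  by (simp add: G.int_pow_eq flip: n mod_eq_dvd_iff)

lemma pt_closed [simp]: "pt i \<in> X"
  by (simp add: pt z)

lemma pow_pt: "(\<pi> [^]\<^bsub>G\<^esub> i) (pt j) = pt (i + j)"
  by (simp add: pt G.int_pow_mult z)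

lemma pt_0: "pt 0 = z"
  by (simp add: pt z)

lemma c_closed [simp]: "c i \<in> carrier G"
  by (simp add: c)

lemma c_div: "c i \<otimes>\<^bsub>G\<^esub> inv\<^bsub>G\<^esub> c j = s (pt i) \<otimes>\<^bsub>G\<^esub> inv\<^bsub>G\<^esub> s (pt j)"
  by (simp add: c G.m_assoc G.inv_mult_group G.inv_mult_cancel)

text \<open>The origin of the index shifts in \<open>seq_yb\<close>: conjugation by
  \<open>\<pi> [^] (j + 1)\<close> moves the points \<open>pt (i - j - 1)\<close> and
  \<open>pt (- j - 1)\<close> to \<open>pt i\<close> and \<open>pt 0 = z\<close>.\<close>

lemma s_pt_pow:
  "s (pt i) \<otimes>\<^bsub>G\<^esub> \<pi> [^]\<^bsub>G\<^esub> j =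
    \<pi> [^]\<^bsub>G\<^esub> (j + 1) \<otimes>\<^bsub>G\<^esub> (c (i - j - 1) \<otimes>\<^bsub>G\<^esub> inv\<^bsub>G\<^esub> c (- j - 1))"
proof -
  have "\<pi> [^]\<^bsub>G\<^esub> (j + 1) \<otimes>\<^bsub>G\<^esub> (c (i - j - 1) \<otimes>\<^bsub>G\<^esub> inv\<^bsub>G\<^esub> c (- j - 1)) =
      s (pt i) \<otimes>\<^bsub>G\<^esub> inv\<^bsub>G\<^esub> \<pi> \<otimes>\<^bsub>G\<^esub> \<pi> [^]\<^bsub>G\<^esub> (1 + j)"
    using displacement_conj[OF pow_in_perm_group, of "pt (- j - 1)" "pt (i - j - 1)" "j + 1"]
    by (simp add: c_div pow_pt pt_0 add.commute flip: \<pi>)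
  also have "\<dots> = s (pt i) \<otimes>\<^bsub>G\<^esub> \<pi> [^]\<^bsub>G\<^esub> j"
    by (simp add: G.int_pow_mult G.m_assoc G.inv_mult_cancel)
  finally show ?thesis ..
qed

text \<open>On classes every generator acts like \<open>\<pi>\<close>, by
  \<open>sigma_indep\<close>, and every inverse generator like the inverse of \<open>\<pi>\<close>;
  so exponents add along products.\<close>

lemma perm_group_pow_class:
  assumes "g \<in> perm_group S"
  shows "\<exists>k. \<forall>x\<in>X. s (g x) = s ((\<pi> [^]\<^bsub>G\<^esub> (k :: int)) x)"
  using assms
proof (induction rule: perm_group_induct)
  case one
  show ?case by (rule exI[of _ 0]) simp
next
  case (s x)
  then show ?case
    by (intro exI[of _ 1]) (auto simp: \<pi> z s_apply intro!: sigma_indep)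
next
  case (inv x)
  have "s ((inv\<^bsub>G\<^esub> s x) y) = s ((inv\<^bsub>G\<^esub> \<pi>) y)" if "y \<in> X" for y
    using that inv z by (intro sigma_inv_indep[of x z y]) (simp_all add: \<pi> flip: s_apply)
  then show ?case
    by (intro exI[of _ "- 1"]) (simp add: G.int_pow_neg)
next
  case (mult g h)
  obtain k where k: "\<And>x. x \<in> X \<Longrightarrow> s (g x) = s ((\<pi> [^]\<^bsub>G\<^esub> (k :: int)) x)"
    using mult.IH(1) by blast
  obtain l where l: "\<And>x. x \<in> X \<Longrightarrow> s (h x) = s ((\<pi> [^]\<^bsub>G\<^esub> (l :: int)) x)"
    using mult.IH(2) by blast
  have "s ((g \<otimes>\<^bsub>G\<^esub> h) x) = s ((\<pi> [^]\<^bsub>G\<^esub> (k + l)) x)" if "x \<in> X" for x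
    using that mult.hyps k[of "h x"] l[of x]
      perm_group_class[OF pow_in_perm_group, of "h x" "(\<pi> [^]\<^bsub>G\<^esub> l) x" k]
    by (simp add: G.int_pow_mult)
  then show ?case by blast
qed

lemma s_eq_pt:
  assumes "x \<in> X"
  obtains k where "s x = s (pt k)"
proof -
  obtain g where "g \<in> perm_group S" "g z = x"
    using indec assms z by (auto simp: indecomposable_def X_def)
  then show thesis
    using perm_group_pow_class[of g] z that by (metis pt)
qed

section \<open>The displacement group as the group generated by \<open>c\<close>\<close>

lemma range_c: "range c = {s x \<otimes>\<^bsub>G\<^esub> inv\<^bsub>G\<^esub> \<pi> | x. x \<in> X}"
proof -
  have "s x \<otimes>\<^bsub>G\<^esub> inv\<^bsub>G\<^esub> \<pi> \<in> range c" if x: "x \<in> X" for x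
  proof -
    obtain k where "s x = s (pt k)"
      using s_eq_pt[OF x] .
    then have "s x \<otimes>\<^bsub>G\<^esub> inv\<^bsub>G\<^esub> \<pi> = c k"
      by (simp add: c)
    then show ?thesis by blast
  qed
  moreover have "c i \<in> {s x \<otimes>\<^bsub>G\<^esub> inv\<^bsub>G\<^esub> \<pi> | x. x \<in> X}" for i
    unfolding c using pt_closed by blast
  ultimately show ?thesis by blast
qed

abbreviation D where "D \<equiv> generate G (range c)"

lemma range_c_carrier: "range c \<subseteq> carrier G"
  by auto

lemma D_subgroup: "subgroup D G"
  by (rule G.generate_is_subgroup[OF range_c_carrier])

lemma c_in_D: "c i \<in> D"
  by (simp add: generate.incl)

lemma Dis_eq: "Dis S = G\<lparr>carrier := D\<rparr>"
proof -
  define E where "E = {s x \<otimes>\<^bsub>G\<^esub> inv\<^bsub>G\<^esub> s y | x y. x \<in> X \<and> y \<in> X}"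
  have "E \<subseteq> D"
  proof
    fix g assume "g \<in> E"
    then obtain x y where x: "x \<in> X" and y: "y \<in> X" and g: "g = s x \<otimes>\<^bsub>G\<^esub> inv\<^bsub>G\<^esub> s y"
      by (auto simp: E_def)
    obtain i j where "s x = s (pt i)" "s y = s (pt j)"
      using s_eq_pt x y by metis
    then have "g = c i \<otimes>\<^bsub>G\<^esub> inv\<^bsub>G\<^esub> c j"
      by (simp add: g c_div)
    then show "g \<in> D"
      by (simp add: D_subgroup c_in_D subgroup.m_closed subgroup.m_inv_closed)
  qed
  then have "generate G E \<subseteq> D"
    by (rule G.generate_subgroup_incl[OF _ D_subgroup])
  moreover have "range c \<subseteq> E"
    unfolding range_c E_def \<pi> using z by blast
  then have "D \<subseteq> generate G E"
    by (rule G.mono_generate)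
  ultimately have "generate G E = D" by blast
  then show ?thesis
    by (simp add: Dis_def E_def G_def X_def)
qed

lemma Dis_comm_group: "comm_group (Dis S)"
  unfolding Dis_eq
proof (rule G.generate_comm_group[OF range_c_carrier])
  fix h k assume "h \<in> range c" "k \<in> range c"
  then obtain i j where "h = c i" "k = c j" by blast
  then show "h \<otimes>\<^bsub>G\<^esub> k = k \<otimes>\<^bsub>G\<^esub> h"
    using displacement_comm[of "pt i" "pt j" z] z by (simp add: c \<pi>)
qed

lemma Dis_simps:
  "carrier (Dis S) = D" "mult (Dis S) = mult G" "\<one>\<^bsub>Dis S\<^esub> = \<one>\<^bsub>G\<^esub>"
  "a \<in> D \<Longrightarrow> inv\<^bsub>Dis S\<^esub> a = inv\<^bsub>G\<^esub> a"
  using D_subgroup by (simp_all add: Dis_eq)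

lemma D_comm: "a \<in> D \<Longrightarrow> b \<in> D \<Longrightarrow> a \<otimes>\<^bsub>G\<^esub> b = b \<otimes>\<^bsub>G\<^esub> a"
  using comm_groupE(4)[OF Dis_comm_group] by (simp add: Dis_simps)

lemma D_closed [simp]: "a \<in> D \<Longrightarrow> a \<in> carrier G"
  by (rule subgroup.mem_carrier[OF D_subgroup])

lemma D_mult_closed [simp]: "a \<in> D \<Longrightarrow> b \<in> D \<Longrightarrow> a \<otimes>\<^bsub>G\<^esub> b \<in> D"
  by (rule subgroup.m_closed[OF D_subgroup])

lemma D_inv_closed [simp]: "a \<in> D \<Longrightarrow> inv\<^bsub>G\<^esub> a \<in> D"
  by (rule subgroup.m_inv_closed[OF D_subgroup])

lemma c_generating_seq: "generating_seq (Dis S) n c"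
  unfolding generating_seq_def
proof (intro conjI allI)
  show "c i \<in> carrier (Dis S)" for i
    by (simp add: Dis_simps c_in_D)
  show "c (i mod int n) = c i" for i
    by (simp add: c pt pow_mod)
  show "c 0 = \<one>\<^bsub>Dis S\<^esub>"
    by (simp add: Dis_simps c pt_0 \<pi> z)
  have "range c \<subseteq> D"
    using c_in_D by blast
  from G.generate_consistent[OF this D_subgroup]
  show "generate (Dis S) (range c) = carrier (Dis S)"
    by (simp add: Dis_eq)
qed

text \<open>The generator \<open>c i\<close> sends \<open>sg z w\<close> to
  \<open>sg (pt i) w\<close>, which has the same \<open>s\<close> by
  \<open>sigma_indep\<close>.\<close>

lemma D_class:
  assumes "b \<in> D" "x \<in> X"
  shows "s (b x) = s x"
proof -
  have c_class: "s (c i y) = s y" if "y \<in> X" for i y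
  proof -
    define w where "w = (inv\<^bsub>G\<^esub> \<pi>) y"
    have w: "w \<in> X" "sg z w = y"
      using that z by (simp_all add: w_def \<pi> flip: s_apply)
    have "c i y = sg (pt i) w"
      using that w by (simp add: c w_def flip: s_apply)
    then show ?thesis
      using sigma_indep[of "pt i" z w] w z by simp
  qed
  have "b \<in> carrier G \<and> (\<forall>x\<in>X. s (b x) = s x)"
    using assms(1)
  proof (induction rule: generate.induct)
    case (inv h)
    then obtain i where h: "h = c i" by blast
    have "s ((inv\<^bsub>G\<^esub> h) x) = s x" if "x \<in> X" for x
      using c_class[of "(inv\<^bsub>G\<^esub> h) x" i] that by (simp add: h)
    then show ?case by (simp add: h)
  qed (auto simp: c_class)
  with assms show ?thesis by blast
qed

section \<open>The homomorphism and its surjectivity\<close>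

definition \<Phi> where "\<Phi> = (\<lambda>(b, j). (\<pi> [^]\<^bsub>G\<^esub> (j :: int)) (b z))"

lemma \<Phi>_closed: "b \<in> D \<Longrightarrow> \<Phi> (b, j) \<in> X"
  by (simp add: \<Phi>_def z)

text \<open>Displacements fix classes, so \<open>b\<close> leaves no trace. This matches
  \<open>sigma\<close> in \<open>seq_yb\<close>, which ignores the group component of its first
  argument.\<close>

lemma s_\<Phi>: "b \<in> D \<Longrightarrow> s (\<Phi> (b, j)) = s (pt j)"
  unfolding \<Phi>_def prod.case pt
  by (rule perm_group_class[OF pow_in_perm_group]) (simp_all add: z D_class)

lemma s_pt_\<Phi>:
  assumes "b \<in> D"
  shows "s (pt i) (\<Phi> (b, j)) = \<Phi> (b \<otimes>\<^bsub>G\<^esub> c (i - j - 1) \<otimes>\<^bsub>G\<^esub> inv\<^bsub>G\<^esub> c (- j - 1), j + 1)"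
proof -
  have "s (pt i) (\<Phi> (b, j)) = (s (pt i) \<otimes>\<^bsub>G\<^esub> \<pi> [^]\<^bsub>G\<^esub> j) (b z)"
    using assms z by (simp add: \<Phi>_def)
  also have "\<dots> = (\<pi> [^]\<^bsub>G\<^esub> (j + 1)) (((c (i - j - 1) \<otimes>\<^bsub>G\<^esub> inv\<^bsub>G\<^esub> c (- j - 1)) \<otimes>\<^bsub>G\<^esub> b) z)"
    unfolding s_pt_pow using assms z by simp
  \<comment> \<open>\<open>s_pt_pow\<close> puts the displacement to the left of \<open>b\<close>,
    \<open>seq_yb\<close> to the right; commutativity of \<open>D\<close> reconciles them.\<close>
  also have "(c (i - j - 1) \<otimes>\<^bsub>G\<^esub> inv\<^bsub>G\<^esub> c (- j - 1)) \<otimes>\<^bsub>G\<^esub> b =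
      b \<otimes>\<^bsub>G\<^esub> c (i - j - 1) \<otimes>\<^bsub>G\<^esub> inv\<^bsub>G\<^esub> c (- j - 1)"
    using D_comm[of "c (i - j - 1) \<otimes>\<^bsub>G\<^esub> inv\<^bsub>G\<^esub> c (- j - 1)" b] assms
    by (simp add: c_in_D G.m_assoc)
  finally show ?thesis
    by (simp add: \<Phi>_def)
qed

text \<open>Lets \<open>\<Phi>\<close> be computed with arbitrary integers \<open>j\<close> and
  still descend to residues modulo \<open>n\<close>.\<close>

lemma \<Phi>_mod: "\<Phi> (b, j mod int n) = \<Phi> (b, j)"
  by (simp add: \<Phi>_def pow_mod)

lemma \<Phi>_hom: "\<Phi> \<in> yb_hom (seq_yb (Dis S) n c) S"
  by (auto simp: yb_hom_def seq_yb_def Dis_simps c_in_D \<Phi>_closed \<Phi>_mod s_\<Phi> s_pt_\<Phi>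
      simp flip: X_def s_apply)

text \<open>The image contains \<open>z\<close> and is stable under the permutation group, which is
  transitive. Stability is shown for \<open>W\<close>, with all integers as exponents, so that
  \<open>j + 1\<close> and \<open>j - 1\<close> need no reduction.\<close>

lemma \<Phi>_surj: "\<Phi> ` (D \<times> carrier (integer_mod_group n)) = X"
proof
  show "\<Phi> ` (D \<times> carrier (integer_mod_group n)) \<subseteq> X"
    by (auto simp: \<Phi>_closed)
  define W where "W = \<Phi> ` (D \<times> UNIV)"
  have WX: "W \<subseteq> X"
    by (auto simp: W_def \<Phi>_closed)
  have "g w \<in> W" if "g \<in> perm_group S" "w \<in> W" for g w
    using that
  proof (induction arbitrary: w rule: perm_group_induct)
    case one
    then show ?case using WX by auto
  next
    case (s x)
    obtain i where i: "s x = s (pt i)"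
      using s_eq_pt[OF s(1)] .
    obtain b j where "b \<in> D" "w = \<Phi> (b, j)"
      using s(2) by (auto simp: W_def)
    then show ?case
      by (simp add: i s_pt_\<Phi> W_def c_in_D)
  next
    case (inv x)
    obtain i where i: "s x = s (pt i)"
      using s_eq_pt[OF inv(1)] .
    obtain b j where b: "b \<in> D" and w: "w = \<Phi> (b, j)"
      using inv(2) by (auto simp: W_def)
    \<comment> \<open>Found by solving \<open>s_pt_\<Phi>\<close> at \<open>j - 1\<close> for the
      argument: there the indices are \<open>i - j\<close> and \<open>- j\<close>.\<close>
    define v where "v = \<Phi> (b \<otimes>\<^bsub>G\<^esub> c (- j) \<otimes>\<^bsub>G\<^esub> inv\<^bsub>G\<^esub> c (i - j), j - 1)"
    have v: "v \<in> W"
      using b by (simp add: v_def W_def c_in_D)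
    have "s x v = w"
      using b by (simp add: i v_def w s_pt_\<Phi> c_in_D G.m_assoc G.inv_mult_cancel)
    then have "(inv\<^bsub>G\<^esub> s x) w = v"
      using v WX inv(1) by auto
    with v show ?case by simp
  next
    case (mult g h)
    then show ?case using WX by (simp add: subset_iff)
  qed
  moreover have "z \<in> W"
  proof -
    have "\<Phi> (\<one>\<^bsub>G\<^esub>, 0) = z"
      by (simp add: \<Phi>_def z)
    then show ?thesis
      unfolding W_def using generate.one[of G "range c"] by (metis SigmaI UNIV_I image_eqI)
  qed
  moreover have "\<exists>g\<in>perm_group S. g z = x" if "x \<in> X" for x
    using indec z that by (simp add: indecomposable_def flip: X_def)
  ultimately have "X \<subseteq> W" by blast
  also have "W \<subseteq> \<Phi> ` (D \<times> carrier (integer_mod_group n))"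
  proof
    fix w assume "w \<in> W"
    then obtain b j where "b \<in> D" "w = \<Phi> (b, j mod int n)"
      by (auto simp: W_def \<Phi>_mod)
    then show "w \<in> \<Phi> ` (D \<times> carrier (integer_mod_group n))"
      by (intro image_eqI[of _ _ "(b, j mod int n)"]) simp_all
  qed
  finally show "X \<subseteq> \<Phi> ` (D \<times> carrier (integer_mod_group n))" .
qed

lemma homomorphic_image_seq_yb: "homomorphic_image S (seq_yb (Dis S) n c)"
  unfolding homomorphic_image_def
proof (intro conjI bexI)
  show "yb_solution (seq_yb (Dis S) n c)"
    by (rule comm_group.seq_yb_solution[OF Dis_comm_group c_generating_seq])
  show "\<Phi> ` carrier (seq_yb (Dis S) n c) = carrier S"
    using \<Phi>_surj by (simp add: seq_yb_def Dis_simps X_def)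
qed (fact yb \<Phi>_hom)+

end

theorem proposition5p2:
  fixes S :: "'a yb" and z :: 'a and \<pi> :: "'a \<Rightarrow> 'a" and n :: nat
    and pt :: "int \<Rightarrow> 'a" and c :: "int \<Rightarrow> 'a \<Rightarrow> 'a"
  assumes "yb_solution S"
    and "indecomposable S"
    and "mp_level_1 S \<or> mp_level_2 S"
    and "z \<in> carrier S"
    and "\<pi> = sigma_perm S z"
    and "n = group.ord (BijGroup (carrier S)) \<pi>"
    and "\<And>i. pt i = (\<pi> [^]\<^bsub>BijGroup (carrier S)\<^esub> i) z"
    and "\<And>i. c i = sigma_perm S (pt i) \<otimes>\<^bsub>BijGroup (carrier S)\<^esub> inv\<^bsub>BijGroup (carrier S)\<^esub> \<pi>"
  shows "comm_group (Dis S) \<and> generating_seq (Dis S) n c \<and>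
         homomorphic_image S (seq_yb (Dis S) n c)"
proof -
  interpret yb S "carrier S" "BijGroup (carrier S)"
    by unfold_locales (simp_all add: assms(1))
  interpret yb_level_le_2 S "carrier S" "BijGroup (carrier S)"
    by unfold_locales (rule mp_level_imp_tau_indep[OF assms(3)])
  interpret yb_base_point S "carrier S" "BijGroup (carrier S)" z \<pi> n pt c
    by unfold_locales (fact assms)+
  show ?thesis
    by (intro conjI Dis_comm_group c_generating_seq homomorphic_image_seq_yb)
qed

end
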